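(* Let $T$ be the Sierpiński triangle (described in the context). For $n\ge 1$ let $A_n$ be the number of distinct upward oriented triangular patterns of side length $n$ occurring in $T$, and let $A'_n$ be the number of distinct downward oriented triangular patterns of side length $n$ occurring in $T$. Then $$A_n = 4n^2-6n+4 \quad\text{for all } n\ge 1,$$ and $A'_1=1$ and $$A'_n = n^2-3n+4 \quad\text{for all } n\ge 2.$$
   Context: Unit triangles of an infinite equilateral triangular region (apex at the top) are indexed by pairs $(r,c)$ of integers with $r\ge 0$ (the row, counted from the top starting at $0$) and $0\le c\le 2r$ (the column, counted from the left starting at $0$). Row $r$ consists, from left to right, of alternately upward-pointing and downward-pointing unit triangles, starting and ending with an upward one: $(r,c)$ is upward if $c$ is even and downward if $c$ is odd. The Sierpiński triangle $T$ is the colouring of these unit triangles by $\{\text{filled},\text{unfilled}\}$ in which the upward triangle $(r,2j)$ is filled if and only if $\binom{r}{j}$ is odd, and every downward triangle is unfilled. (Equivalently, $T$ is the limit of $T_n=\mu^n(\blacktriangle)$, where the substitution $\mu$ replaces each unit triangle by a triangle of side $2$ consisting of four unit triangles: an unfilled upward (resp. downward) unit triangle by four unfilled unit triangles, and a filled upward unit triangle by a side-2 upward triangle whose three corner upward unit triangles are filled and whose central downward unit triangle is unfilled.) An upward oriented pattern of side length $m\ge1$ occurring in $T$ is a map $(i,k)\mapsto$ colour of the unit triangle $(r+i,c+k)$ of $T$, defined on $\{(i,k):0\le i\le m-1,\ 0\le k\le 2i\}$, for some position $(r,c)$ with $r\ge0$, $c$ even, $0\le c\le 2r$. A downward oriented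 pattern of side length $m\ge1$ occurring in $T$ is a map $(i,k)\mapsto$ colour of $(r+i,c+2i+k)$, defined on $\{(i,k):0\le i\le m-1,\ 0\le k\le 2(m-i)-2\}$, for some position $(r,c)$ with $c$ odd, $c\ge1$ and $c+2m-2\le 2r$. Two occurrences give the same pattern iff these maps are equal; "number of distinct patterns" counts distinct maps. *)

theory Defs
  imports Complex_Main "HOL-Library.FuncSet"
begin

datatype colour = Filled | Unfilled

text \<open>
  The unit triangle \<open>(r, c)\<close> is meaningful for \<open>c \<le> 2 * r\<close> only; it points upward iff \<open>c\<close> is even.
\<close>

definition sierpinski :: "nat \<Rightarrow> nat \<Rightarrow> colour" where
  "sierpinski r c = (if even c \<and> odd (r choose (c div 2)) then Filled else Unfilled)"

definition up_domain :: "nat \<Rightarrow> (nat \<times> nat) set" where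
  "up_domain m = {(i, k). i \<le> m - 1 \<and> k \<le> 2 * i}"

definition down_domain :: "nat \<Rightarrow> (nat \<times> nat) set" where
  "down_domain m = {(i, k). i \<le> m - 1 \<and> k \<le> 2 * (m - i) - 2}"

text \<open>
  The natural subtractions here and above are exact for side length \<open>m \<ge> 1\<close>.
  Patterns are maps on a finite domain, represented as extensional functions.
\<close>

definition up_pattern_at :: "nat \<Rightarrow> nat \<Rightarrow> nat \<Rightarrow> nat \<times> nat \<Rightarrow> colour" where
  "up_pattern_at m r c = restrict (\<lambda>(i, k). sierpinski (r + i) (c + k)) (up_domain m)"

definition down_pattern_at :: "nat \<Rightarrow> nat \<Rightarrow> nat \<Rightarrow> nat \<times> nat \<Rightarrow> colour" where
  "down_pattern_at m r c = restrict (\<lambda>(i, k). sierpinski (r + i) (c + 2 * i + k)) (down_domain m)"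

definition up_patterns :: "nat \<Rightarrow> (nat \<times> nat \<Rightarrow> colour) set" where
  "up_patterns m = {up_pattern_at m r c | r c. even c \<and> c \<le> 2 * r}"

definition down_patterns :: "nat \<Rightarrow> (nat \<times> nat \<Rightarrow> colour) set" where
  "down_patterns m = {down_pattern_at m r c | r c. odd c \<and> 1 \<le> c \<and> c + 2 * m - 2 \<le> 2 * r}"

end

theory Submission
  imports Defs
begin

text \<open>
  Modulo \<open>2\<close>, Pascal's rule makes every window of the triangle a linear function of a piece of one
  row. A downward pattern of side \<open>n\<close> is determined by the \<open>n - 1\<close> upward cells of its top row. An
  upward pattern of side \<open>n\<close> determines, and is determined by, the \<open>2 * n - 1\<close> cells centred at its
  apex in the row of the apex (zero-padded beyond the triangle): its two slanted sides depend on
  the two halves of that stretch in a unitriangular way. So both counts are values of the factor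
  complexity \<open>p\<close> of the zero-padded rows of Pascal's triangle modulo \<open>2\<close>, and it remains to show
  \<open>p L = L\<^sup>2 - L + 2\<close> for \<open>L \<ge> 1\<close>. Row \<open>2 * r\<close> is row \<open>r\<close> interleaved with zeros and row \<open>2 * r + 1\<close>
  is row \<open>r\<close> with every letter doubled, so each factor arises from a factor of about half the
  length in one of four ways; the four ways overlap only in the words \<open>00\<dots>0\<close>, \<open>10\<dots>0\<close>, \<open>0\<dots>01\<close>
  and \<open>11\<dots>1\<close>, which yields a recursion for \<open>p\<close>.
\<close>

section \<open>Zero-padded rows of Pascal's triangle modulo 2\<close>

text \<open>Columns are integers so that the zero padding on the left belongs to the function and
  Pascal's rule holds at every column without a boundary case.\<close>

definition pascal2 :: "nat \<Rightarrow> int \<Rightarrow> bool" where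
  "pascal2 r c \<longleftrightarrow> 0 \<le> c \<and> odd (r choose nat c)"

lemma pascal2_0 [simp]: "pascal2 0 c \<longleftrightarrow> c = 0"
  by (cases "nat c") (auto simp: pascal2_def)

lemma pascal2_Suc: "pascal2 (Suc r) c \<longleftrightarrow> pascal2 r (c - 1) \<noteq> pascal2 r c"
proof (cases "c \<le> 0")
  case True
  then show ?thesis
    by (cases "c = 0") (auto simp: pascal2_def)
next
  case False
  then have "c = int (Suc (nat c - 1))"
    by simp
  then obtain k where "c = int (Suc k)" ..
  then show ?thesis
    by (simp add: pascal2_def nat_add_distrib)
qed

lemma pascal2_support: "pascal2 r c \<Longrightarrow> 0 \<le> c \<and> c \<le> int r"
  by (auto simp: pascal2_def) (metis binomial_eq_0 even_zero nat_le_iff not_less)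

text \<open>Modulo 2, (1 + x)^2 = 1 + x^2: over two rows the middle terms cancel, so a cell is the
  sum of the cells in columns \<open>d - 2\<close> and \<open>d\<close>, and column parities never
  mix.\<close>

lemma pascal2_double: "pascal2 (2 * r) (2 * c) = pascal2 r c \<and> \<not> pascal2 (2 * r) (2 * c + 1)"
proof (induction r arbitrary: c)
  case 0
  show ?case by (simp, presburger)
next
  case (Suc r)
  have two_steps: "pascal2 (2 * Suc r) d \<longleftrightarrow> pascal2 (2 * r) (d - 2) \<noteq> pascal2 (2 * r) d" for d
    by (auto simp: pascal2_Suc)
  have "2 * c - 2 = 2 * (c - 1)" "2 * c + 1 - 2 = 2 * (c - 1) + 1"
    by auto
  then show ?case
    unfolding two_steps by (simp only: Suc.IH pascal2_Suc) simp
qed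

lemma pascal2_even_row:
  "pascal2 (2 * r) (2 * c) = pascal2 r c" "\<not> pascal2 (2 * r) (2 * c + 1)"
  using pascal2_double by auto

text \<open>Of the two cells above, exactly one lies in an odd column of row \<open>2 * r\<close>
  and is zero; the other supplies the value.\<close>

lemma pascal2_odd_row:
  "pascal2 (2 * r + 1) (2 * c) = pascal2 r c" "pascal2 (2 * r + 1) (2 * c + 1) = pascal2 r c"
proof -
  have "2 * c - 1 = 2 * (c - 1) + 1"
    by simp
  then show "pascal2 (2 * r + 1) (2 * c) = pascal2 r c"
    by (simp only: Suc_eq_plus1 [symmetric] pascal2_Suc pascal2_even_row) simp
  show "pascal2 (2 * r + 1) (2 * c + 1) = pascal2 r c"
    by (simp only: Suc_eq_plus1 [symmetric] pascal2_Suc pascal2_even_row) (simp add: pascal2_even_row)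
qed

text \<open>Lucas's theorem modulo 2 with the last \<open>k\<close> binary digits split off; the
  induction strips one digit of \<open>r\<close> and of \<open>c\<close> at a time.\<close>

lemma pascal2_blocks:
  "r < 2 ^ k \<Longrightarrow> 0 \<le> c \<Longrightarrow> c < 2 ^ k \<Longrightarrow>
    pascal2 (2 ^ k * s + r) (2 ^ k * t + c) \<longleftrightarrow> pascal2 s t \<and> pascal2 r c"
proof (induction k arbitrary: r c)
  case 0
  then have "r = 0" "c = 0" by simp_all
  then show ?case by simp
next
  case (Suc k)
  obtain r' where r': "r = 2 * r' \<or> r = 2 * r' + 1"
    by (metis oddE evenE)
  obtain c' where c': "c = 2 * c' \<or> c = 2 * c' + 1"
    by (metis oddE evenE)
  have IH: "pascal2 (2 ^ k * s + r') (2 ^ k * t + c') \<longleftrightarrow> pascal2 s t \<and> pascal2 r' c'"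
    using Suc.prems r' c' by (intro Suc.IH) auto
  have row: "2 ^ Suc k * s + 2 * r' = 2 * (2 ^ k * s + r')"
    "2 ^ Suc k * s + (2 * r' + 1) = 2 * (2 ^ k * s + r') + 1"
    by (auto simp: algebra_simps)
  have col: "2 ^ Suc k * t + 2 * c' = 2 * (2 ^ k * t + c')"
    "2 ^ Suc k * t + (2 * c' + 1) = 2 * (2 ^ k * t + c') + 1"
    by (auto simp: algebra_simps)
  \<comment> \<open>An even row with an odd column makes both sides false; the other three parity
    cases reduce to \<open>IH\<close>.\<close>
  show ?case
    using r' c' by (elim disjE; hypsubst; simp only: row col pascal2_even_row pascal2_odd_row IH simp_thms)
qed

text \<open>Row \<open>2 ^ Suc k - 1\<close> is row \<open>2 ^ k - 1\<close> with every letter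
  doubled.\<close>

lemma pascal2_all_ones: "0 \<le> c \<Longrightarrow> c < 2 ^ k \<Longrightarrow> pascal2 (2 ^ k - 1) c"
proof (induction k arbitrary: c)
  case 0
  then show ?case by simp
next
  case (Suc k)
  have "(2::nat) ^ Suc k - 1 = 2 * (2 ^ k - 1) + 1"
    using one_le_power[of "2::nat" k] unfolding power_Suc by linarith
  moreover obtain c' where c': "c = 2 * c' \<or> c = 2 * c' + 1"
    by (metis oddE evenE)
  moreover have "pascal2 (2 ^ k - 1) c'"
    using Suc.prems c' by (intro Suc.IH) auto
  ultimately show ?case
    by (auto simp only: pascal2_odd_row)
qed

text \<open>
  Row \<open>3\<close> is \<open>1111\<close>, so by the block structure row \<open>3 * 2 ^ k + r\<close> contains a copy of row \<open>r\<close>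
  with zeros around it, away from both ends of the row.
\<close>

lemma pascal2_interior_copy:
  obtains r' j' where "1 \<le> j'" "j' + L \<le> r'"
    "\<And>i. i < L \<Longrightarrow> pascal2 r' (int j' + int i) = pascal2 r (j + int i)"
proof -
  \<comment> \<open>\<open>2 ^ m\<close> exceeds \<open>r\<close>, the absolute value of
    \<open>j\<close> and \<open>L\<close> together, so the window stays within two neighbouring
    blocks.\<close>
  define m where "m = r + nat \<bar>j\<bar> + L + 1"
  define B where "B = (2::nat) ^ m"
  have B: "m < B"
    by (simp add: B_def)
  have pow: "int B = 2 ^ m"
    by (simp add: B_def)
  have bound: "int r + \<bar>j\<bar> + int L < 2 ^ m"
    using B pow m_def by linarith
  \<comment> \<open>Column 0 is moved to the start of block 2, below the second inner 1 of row 3;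
    negative columns fall into block 1.\<close>
  define j' where "j' = nat (int (2 * B) + j)"
  have j': "int j' = int (2 * B) + j"
    using B by (simp add: j'_def m_def)
  have three: "pascal2 3 1" "pascal2 3 2"
    using pascal2_all_ones[of _ 2] by simp_all
  show thesis
  proof (rule that)
    show "1 \<le> j'" "j' + L \<le> B * 3 + r"
      using B j' by (simp_all add: m_def)
    fix i assume "i < L"
    have r: "r < 2 ^ m"
      using B by (simp add: B_def m_def)
    show "pascal2 (B * 3 + r) (int j' + int i) = pascal2 r (j + int i)"
    proof (cases "0 \<le> j + int i")
      case True
      have "pascal2 (2 ^ m * 3 + r) (2 ^ m * 2 + (j + int i)) \<longleftrightarrow> pascal2 3 2 \<and> pascal2 r (j + int i)"
        using r True bound \<open>i < L\<close> by (intro pascal2_blocks) linarith+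
      moreover have col: "int j' + int i = 2 ^ m * 2 + (j + int i)"
        using j' pow by linarith
      ultimately show ?thesis
        unfolding B_def col using three by blast
    next
      case False
      \<comment> \<open>Negative columns read the end of the copy in block 1. Their offset there
        exceeds \<open>r\<close>, so they are zero, as the padding demands.\<close>
      have "pascal2 (2 ^ m * 3 + r) (2 ^ m * 1 + (2 ^ m + j + int i)) \<longleftrightarrow>
          pascal2 3 1 \<and> pascal2 r (2 ^ m + j + int i)"
        using r False bound \<open>i < L\<close> by (intro pascal2_blocks) linarith+
      moreover have col: "int j' + int i = 2 ^ m * 1 + (2 ^ m + j + int i)"
        using j' pow by linarith
      moreover have "\<not> pascal2 r (2 ^ m + j + int i)"
        using bound pascal2_support[of r "2 ^ m + j + int i"] by linarith
      moreover have "\<not> pascal2 r (j + int i)"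
        using False pascal2_support by blast
      ultimately show ?thesis
        unfolding B_def col by blast
    qed
  qed
qed

section \<open>Factor complexity of the rows\<close>

text \<open>Words of length \<open>L\<close> are predicates that vanish from \<open>L\<close> on, so
  equality of words is equality of functions.\<close>

definition row_factor :: "nat \<Rightarrow> nat \<Rightarrow> int \<Rightarrow> nat \<Rightarrow> bool" where
  "row_factor L r j = (\<lambda>i. i < L \<and> pascal2 r (j + int i))"

definition row_factors :: "nat \<Rightarrow> (nat \<Rightarrow> bool) set" where
  "row_factors L = {row_factor L r j | r j. True}"

lemma row_factorsI: "(\<And>i. w i \<longleftrightarrow> i < L \<and> pascal2 r (j + int i)) \<Longrightarrow> w \<in> row_factors L"
  unfolding row_factors_def row_factor_def by blast

lemma row_factors_beyond: "w \<in> row_factors L \<Longrightarrow> L \<le> i \<Longrightarrow> \<not> w i"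
  by (auto simp: row_factors_def row_factor_def)

lemma finite_row_factors: "finite (row_factors L)"
proof (rule finite_subset)
  show "row_factors L \<subseteq> (\<lambda>A i. i \<in> A) ` Pow {..<L}"
  proof
    fix w assume "w \<in> row_factors L"
    then have "Collect w \<in> Pow {..<L}"
      using row_factors_beyond[of w L] by (auto simp: not_le[symmetric])
    then show "w \<in> (\<lambda>A i. i \<in> A) ` Pow {..<L}"
      by (rule rev_image_eqI) simp
  qed
qed simp

lemma zero_in_row_factors: "(\<lambda>i. False) \<in> row_factors L"
  by (rule row_factorsI[of _ _ 0 1]) auto

lemma first_in_row_factors: "0 < L \<Longrightarrow> (\<lambda>i. i = 0) \<in> row_factors L"
  by (rule row_factorsI[of _ _ 0 0]) auto

lemma last_in_row_factors: "0 < L \<Longrightarrow> (\<lambda>i. i = L - 1) \<in> row_factors L"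
  by (rule row_factorsI[of _ _ 0 "- int (L - 1)"]) auto

lemma ones_in_row_factors: "(\<lambda>i. i < L) \<in> row_factors L"
\<comment> \<open>Row \<open>2 ^ L - 1\<close> consists of \<open>2 ^ L\<close> ones, more than
  \<open>L\<close>.\<close>
proof (rule row_factorsI[of _ _ "2 ^ L - 1" 0])
  fix i
  have "int i < 2 ^ L" if "i < L"
    using that by (metis less_exp less_trans of_nat_less_iff of_nat_numeral of_nat_power)
  then show "i < L \<longleftrightarrow> i < L \<and> pascal2 (2 ^ L - 1) (0 + int i)"
    using pascal2_all_ones[of "int i" L] by auto
qed

section \<open>Factors from half-length factors, by parity of row and starting column\<close>

definition sparse0 :: "(nat \<Rightarrow> bool) \<Rightarrow> nat \<Rightarrow> bool" where
  "sparse0 w = (\<lambda>i. even i \<and> w (i div 2))"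

definition sparse1 :: "(nat \<Rightarrow> bool) \<Rightarrow> nat \<Rightarrow> bool" where
  "sparse1 w = (\<lambda>i. odd i \<and> w (i div 2))"

text \<open>With the source lengths used below, the cut at \<open>L\<close> removes half of the last
  pair when \<open>L\<close> is odd, and in \<open>double1\<close> when \<open>L\<close> is even.
  The sparse words need no cut.\<close>

definition double0 :: "nat \<Rightarrow> (nat \<Rightarrow> bool) \<Rightarrow> nat \<Rightarrow> bool" where
  "double0 L w = (\<lambda>i. i < L \<and> w (i div 2))"

definition double1 :: "nat \<Rightarrow> (nat \<Rightarrow> bool) \<Rightarrow> nat \<Rightarrow> bool" where
  "double1 L w = (\<lambda>i. i < L \<and> w ((i + 1) div 2))"

lemma row_factor_even_even:
  "row_factor L (2 * r) (2 * j) = sparse0 (row_factor ((L + 1) div 2) r j)"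
proof
  fix i :: nat
  obtain k where k: "i = 2 * k \<or> i = 2 * k + 1"
    by (metis oddE evenE)
  show "row_factor L (2 * r) (2 * j) i = sparse0 (row_factor ((L + 1) div 2) r j) i"
    using k pascal2_even_row[of r "j + int k"]
    by (auto simp: row_factor_def sparse0_def algebra_simps)
qed

text \<open>The window starts on an interleaved zero, so its first source letter is in column
  \<open>j + 1\<close>.\<close>

lemma row_factor_even_odd:
  "row_factor L (2 * r) (2 * j + 1) = sparse1 (row_factor (L div 2) r (j + 1))"
proof
  fix i :: nat
  obtain k where k: "i = 2 * k \<or> i = 2 * k + 1"
    by (metis oddE evenE)
  show "row_factor L (2 * r) (2 * j + 1) i = sparse1 (row_factor (L div 2) r (j + 1)) i"
    using k pascal2_even_row[of r "j + int k"] pascal2_even_row[of r "j + int k + 1"]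
    by (auto simp: row_factor_def sparse1_def algebra_simps)
qed

lemma row_factor_odd_even:
  "row_factor L (2 * r + 1) (2 * j) = double0 L (row_factor ((L + 1) div 2) r j)"
proof
  fix i :: nat
  obtain k where k: "i = 2 * k \<or> i = 2 * k + 1"
    by (metis oddE evenE)
  show "row_factor L (2 * r + 1) (2 * j) i = double0 L (row_factor ((L + 1) div 2) r j) i"
    using k pascal2_odd_row[of r "j + int k"]
    by (auto simp: row_factor_def double0_def algebra_simps)
qed

text \<open>The window starts on the second half of pair \<open>j\<close>; for \<open>L > 0\<close>
  it meets \<open>L div 2 + 1\<close> pairs.\<close>

lemma row_factor_odd_odd:
  "row_factor L (2 * r + 1) (2 * j + 1) = double1 L (row_factor (L div 2 + 1) r j)"
proof
  fix i :: nat
  obtain k where k: "i = 2 * k \<or> i = 2 * k + 1"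
    by (metis oddE evenE)
  show "row_factor L (2 * r + 1) (2 * j + 1) i = double1 L (row_factor (L div 2 + 1) r j) i"
    using k pascal2_odd_row[of r "j + int k"] pascal2_odd_row[of r "j + int k + 1"]
    by (auto simp: row_factor_def double1_def algebra_simps)
qed

lemma row_factors_split:
  "row_factors L = sparse0 ` row_factors ((L + 1) div 2) \<union> sparse1 ` row_factors (L div 2)
     \<union> double0 L ` row_factors ((L + 1) div 2) \<union> double1 L ` row_factors (L div 2 + 1)"
  (is "_ = ?R")
proof
  have in_factors: "row_factor l s t \<in> row_factors l" for l s t
    by (auto simp: row_factors_def)
  show "row_factors L \<subseteq> ?R"
  proof
    fix w assume "w \<in> row_factors L"
    then obtain r j where w: "w = row_factor L r j"
      by (auto simp: row_factors_def)
    obtain r' where r': "r = 2 * r' \<or> r = 2 * r' + 1"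
      by (metis oddE evenE)
    obtain j' where j': "j = 2 * j' \<or> j = 2 * j' + 1"
      by (metis oddE evenE)
    show "w \<in> ?R"
      using r' j' unfolding w
      by (elim disjE; hypsubst; simp only: row_factor_even_even row_factor_even_odd
          row_factor_odd_even row_factor_odd_odd) (auto intro: in_factors)
  qed
  show "?R \<subseteq> row_factors L"
  proof -
    have image: "f ` row_factors m \<subseteq> row_factors L" if "\<And>r j. f (row_factor m r j) \<in> row_factors L" for f m
      using that by (auto simp: row_factors_def)
    \<comment> \<open>Starting at \<open>j - 1\<close> undoes the shift to \<open>j + 1\<close> in
      this parity case.\<close>
    have "sparse1 (row_factor (L div 2) r j) \<in> row_factors L" for r j
      using in_factors[of L "2 * r" "2 * (j - 1) + 1"] unfolding row_factor_even_odd by simp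
    then show ?thesis
      by (intro Un_least image)
        (simp_all only: row_factor_even_even[symmetric] row_factor_odd_even[symmetric]
          row_factor_odd_odd[symmetric] in_factors)
  qed
qed

section \<open>Injectivity of the four constructions\<close>

lemma inj_sparse0: "inj sparse0"
proof (rule injI, rule ext)
  fix v w i assume "sparse0 v = sparse0 w"
  then have "sparse0 v (2 * i) = sparse0 w (2 * i)" by simp
  then show "v i = w i" by (simp add: sparse0_def)
qed

lemma inj_sparse1: "inj sparse1"
proof (rule injI, rule ext)
  fix v w i assume "sparse1 v = sparse1 w"
  then have "sparse1 v (2 * i + 1) = sparse1 w (2 * i + 1)" by simp
  then show "v i = w i" by (simp add: sparse1_def)
qed

lemma inj_on_double0: "inj_on (double0 L) (row_factors ((L + 1) div 2))"
proof (rule inj_onI, rule ext)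
  fix v w i
  assume v: "v \<in> row_factors ((L + 1) div 2)" and w: "w \<in> row_factors ((L + 1) div 2)"
    and "double0 L v = double0 L w"
  then have eq: "double0 L v (2 * i) = double0 L w (2 * i)" by simp
  show "v i = w i"
  proof (cases "2 * i < L")
    case True
    with eq show ?thesis by (simp add: double0_def)
  next
    case False
    then have "(L + 1) div 2 \<le> i" by linarith
    with v w show ?thesis by (simp add: row_factors_beyond)
  qed
qed

lemma inj_on_double1:
  assumes "0 < L"
  shows "inj_on (double1 L) (row_factors (L div 2 + 1))"
proof (rule inj_onI, rule ext)
  fix v w i
  assume v: "v \<in> row_factors (L div 2 + 1)" and w: "w \<in> row_factors (L div 2 + 1)"
    and "double1 L v = double1 L w"
  \<comment> \<open>Letter \<open>i\<close> is read at the first position of its pair; for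
    \<open>i = 0\<close> truncated subtraction gives position 0, which indeed carries letter
    0.\<close>
  then have eq: "double1 L v (2 * i - 1) = double1 L w (2 * i - 1)" by simp
  show "v i = w i"
  proof (cases "2 * i - 1 < L")
    case True
    moreover have "(2 * i - 1 + 1) div 2 = i" by (cases i) auto
    ultimately show ?thesis using eq by (simp add: double1_def)
  next
    case False
    then have "L div 2 + 1 \<le> i" using assms by linarith
    with v w show ?thesis by (simp add: row_factors_beyond)
  qed
qed

section \<open>Pairwise overlaps of the four images\<close>

lemma sparse0_Int_sparse1: "sparse0 ` V \<inter> sparse1 ` W \<subseteq> {\<lambda>i. False}"
proof
  fix w assume "w \<in> sparse0 ` V \<inter> sparse1 ` W"
  then have "\<not> w i" for i
    by (cases "even i") (auto simp: sparse0_def sparse1_def dest: fun_cong[of _ _ i])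
  then show "w \<in> {\<lambda>i. False}" by auto
qed

text \<open>
  The two descriptions of \<open>w\<close> together tie each letter to its neighbour on either side, so only a
  boundary letter, which lacks one neighbour, can be exceptional.
\<close>

lemma sparse0_Int_double0:
  assumes "w \<in> sparse0 ` V" "w \<in> double0 L ` W"
  shows "w = (\<lambda>i. False) \<or> odd L \<and> w = (\<lambda>i. i = L - 1)"
proof -
  have beyond: "\<not> w i" if "L \<le> i" for i
    using assms(2) that by (auto simp: double0_def)
  have odd: "\<not> w i" if "odd i" for i
    using assms(1) that by (auto simp: sparse0_def)
  have "w (2 * i) = w (2 * i + 1)" if "2 * i + 1 < L" for i
    using assms(2) that by (auto simp: double0_def)
  then have zero: "\<not> w i" if "i + 1 < L" for i
    using odd[of i] odd[of "i + 1"] that by (cases "even i") auto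
  have "i = L - 1 \<and> odd L" if "w i" for i
  proof -
    from that have "i < L" "\<not> i + 1 < L" "even i"
      using beyond zero odd not_le by blast+
    then have "L = i + 1" by linarith
    with \<open>even i\<close> show ?thesis by simp
  qed
  then show ?thesis by (auto simp: fun_eq_iff)
qed

text \<open>For odd \<open>L\<close> the unpaired last position is even, hence zero anyway; no
  exception survives.\<close>

lemma sparse1_Int_double0:
  assumes "w \<in> sparse1 ` V" "w \<in> double0 L ` W"
  shows "w = (\<lambda>i. False)"
proof -
  have beyond: "\<not> w i" if "L \<le> i" for i
    using assms(2) that by (auto simp: double0_def)
  have even: "\<not> w i" if "even i" for i
    using assms(1) that by (auto simp: sparse1_def)
  have pair: "w (2 * i) = w (2 * i + 1)" if "2 * i + 1 < L" for i
    using assms(2) that by (auto simp: double0_def)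
  have "\<not> w i" for i
    using pair[of "i div 2"] even[of "2 * (i div 2)"] even[of i] beyond[of i]
    by (cases "even i"; cases "i < L") auto
  then show ?thesis by auto
qed

text \<open>The pairs now start at odd positions. Position 0 is free, while an unpaired last
  position is odd and hence zero.\<close>

lemma sparse0_Int_double1:
  assumes "w \<in> sparse0 ` V" "w \<in> double1 L ` W"
  shows "w = (\<lambda>i. False) \<or> w = (\<lambda>i. i = 0)"
proof -
  have beyond: "\<not> w i" if "L \<le> i" for i
    using assms(2) that by (auto simp: double1_def)
  have odd: "\<not> w i" if "odd i" for i
    using assms(1) that by (auto simp: sparse0_def)
  have pair: "w (2 * i + 1) = w (2 * i + 2)" if "2 * i + 2 < L" for i
    using assms(2) that by (auto simp: double1_def)
  have "\<not> w i" if i: "0 < i" for i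
  proof (cases "even i \<and> i < L")
    case True
    then obtain k where "i = 2 * k + 2"
      using i by (metis add_2_eq_Suc' dvd_def mult_Suc_right not0_implies_Suc not_gr_zero
          mult_zero_right add.commute)
    then show ?thesis using pair[of k] odd[of "2 * k + 1"] True by simp
  next
    case False
    then show ?thesis using odd beyond not_le by blast
  qed
  then show ?thesis
    by (metis neq0_conv)
qed

lemma sparse1_Int_double1:
  assumes "w \<in> sparse1 ` V" "w \<in> double1 L ` W"
  shows "w = (\<lambda>i. False) \<or> even L \<and> w = (\<lambda>i. i = L - 1)"
proof -
  have beyond: "\<not> w i" if "L \<le> i" for i
    using assms(2) that by (auto simp: double1_def)
  have even: "\<not> w i" if "even i" for i
    using assms(1) that by (auto simp: sparse1_def)
  have pair: "w (2 * i + 1) = w (2 * i + 2)" if "2 * i + 2 < L" for i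
    using assms(2) that by (auto simp: double1_def)
  have zero: "\<not> w i" if "i + 1 < L" for i
  proof (cases "even i")
    case True
    then show ?thesis by (rule even)
  next
    case False
    then obtain k where "i = 2 * k + 1" by (metis oddE)
    then show ?thesis using pair[of k] even[of "2 * k + 2"] that by simp
  qed
  have "i = L - 1 \<and> even L" if "w i" for i
  proof -
    from that have "i < L" "\<not> i + 1 < L" "odd i"
      using beyond zero even not_le by blast+
    then have "L = i + 1" by linarith
    with \<open>odd i\<close> show ?thesis by simp
  qed
  then show ?thesis by (auto simp: fun_eq_iff)
qed

text \<open>The two pairings interlock and link all neighbours, so the word is constant up to
  \<open>L\<close>.\<close>

lemma double0_Int_double1:
  assumes "w \<in> double0 L ` V" "w \<in> double1 L ` W"
  shows "w = (\<lambda>i. False) \<or> w = (\<lambda>i. i < L)"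
proof -
  have beyond: "\<not> w i" if "L \<le> i" for i
    using assms(2) that by (auto simp: double1_def)
  have pair0: "w (2 * i) = w (2 * i + 1)" if "2 * i + 1 < L" for i
    using assms(1) that by (auto simp: double0_def)
  have pair1: "w (2 * i + 1) = w (2 * i + 2)" if "2 * i + 2 < L" for i
    using assms(2) that by (auto simp: double1_def)
  have step: "w i = w (i + 1)" if "i + 1 < L" for i
  proof (cases "even i")
    case True
    then show ?thesis using that pair0[of "i div 2"] by simp
  next
    case False
    then obtain k where "i = 2 * k + 1" by (metis oddE)
    then show ?thesis using that pair1[of k] by simp
  qed
  have const: "i < L \<Longrightarrow> w i = w 0" for i
    by (induction i) (use step in auto)
  have "w i \<longleftrightarrow> i < L \<and> w 0" for i
    using const[of i] beyond[of i] by (cases "i < L") auto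
  then obtain b where "w = (\<lambda>i. i < L \<and> b)" by blast
  then show ?thesis by (cases b) simp_all
qed

text \<open>The four images are joined one at a time, and each overlap with the union so far is
  subtracted.\<close>

lemma card_row_factors_split:
  assumes "3 \<le> L"
  shows "card (row_factors L) + 6 =
    2 * card (row_factors ((L + 1) div 2)) + card (row_factors (L div 2)) + card (row_factors (L div 2 + 1))"
proof -
  define A where "A = sparse0 ` row_factors ((L + 1) div 2)"
  define B where "B = sparse1 ` row_factors (L div 2)"
  define C where "C = double0 L ` row_factors ((L + 1) div 2)"
  define D where "D = double1 L ` row_factors (L div 2 + 1)"
  define z :: "nat \<Rightarrow> bool" where "z = (\<lambda>i. False)"
  define e :: "nat \<Rightarrow> bool" where "e = (\<lambda>i. i = 0)"
  define l where "l = (\<lambda>i. i = L - 1)"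
  define u where "u = (\<lambda>i. i < L)"
  have fin: "finite A" "finite B" "finite C" "finite D"
    by (simp_all add: A_def B_def C_def D_def finite_row_factors)
  have card: "card A = card (row_factors ((L + 1) div 2))" "card B = card (row_factors (L div 2))"
    "card C = card (row_factors ((L + 1) div 2))" "card D = card (row_factors (L div 2 + 1))"
    unfolding A_def B_def C_def D_def using assms
    by (intro card_image inj_on_double0 inj_on_double1 inj_on_subset[OF inj_sparse0]
        inj_on_subset[OF inj_sparse1]; simp)+
  have neq: "z \<noteq> e" "z \<noteq> l" "z \<noteq> u" "e \<noteq> l" "e \<noteq> u" "l \<noteq> u"
  proof -
    have "\<not> z 0" "\<not> z (L - 1)" "e 0" "\<not> e 1" "l (L - 1)" "\<not> l 0" "\<not> l 1" "u 0" "u 1"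
      using assms by (simp_all add: z_def e_def l_def u_def)
    then show "z \<noteq> e" "z \<noteq> l" "z \<noteq> u" "e \<noteq> l" "e \<noteq> u" "l \<noteq> u"
      by metis+
  qed
  have z: "z \<in> A" "z \<in> B" "z \<in> C" "z \<in> D"
    unfolding A_def B_def C_def D_def z_def
    by (auto intro!: rev_image_eqI[OF zero_in_row_factors] simp: sparse0_def sparse1_def double0_def double1_def)
  \<comment> \<open>\<open>double1\<close> keeps only one copy of source letter 0, so
    \<open>e\<close> is its own source in both images.\<close>
  have "sparse0 e = e" "double1 L e = e"
    using assms unfolding sparse0_def double1_def e_def fun_eq_iff by presburger+
  then have e: "e \<in> A" "e \<in> D"
    unfolding A_def D_def e_def using assms by (auto intro!: rev_image_eqI[OF first_in_row_factors])
  have "double0 L (\<lambda>i. i < (L + 1) div 2) = u" "double1 L (\<lambda>i. i < L div 2 + 1) = u"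
    unfolding double0_def double1_def u_def fun_eq_iff by presburger+
  then have u: "u \<in> C" "u \<in> D"
    unfolding C_def D_def by (metis imageI ones_in_row_factors)+
  \<comment> \<open>The parity of the last position decides which sparse and which doubled image
    contain \<open>l\<close>; the doubled one arises by cutting the last pair.\<close>
  have l_odd: "l \<in> A \<and> l \<in> C" if "odd L"
  proof -
    have "sparse0 (\<lambda>i. i = (L + 1) div 2 - 1) = l" "double0 L (\<lambda>i. i = (L + 1) div 2 - 1) = l"
      using that unfolding sparse0_def double0_def l_def fun_eq_iff by presburger+
    moreover have "(\<lambda>i. i = (L + 1) div 2 - 1) \<in> row_factors ((L + 1) div 2)"
      using assms by (intro last_in_row_factors) linarith
    ultimately show ?thesis
      unfolding A_def C_def by (metis imageI)
  qed
  have l_even: "l \<in> B \<and> l \<in> D" if "even L"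
  proof -
    define m where "m = L div 2 - 1"
    have m: "L = 2 * m + 2"
      using assms that unfolding m_def by presburger
    have "sparse1 (\<lambda>i. i = L div 2 - 1) = l"
      unfolding sparse1_def l_def fun_eq_iff m by simp presburger
    moreover have "double1 L (\<lambda>i. i = L div 2 + 1 - 1) = l"
      unfolding double1_def l_def fun_eq_iff m by simp presburger
    moreover have "(\<lambda>i. i = L div 2 - 1) \<in> row_factors (L div 2)"
      "(\<lambda>i. i = L div 2 + 1 - 1) \<in> row_factors (L div 2 + 1)"
      using assms by (intro last_in_row_factors; linarith)+
    ultimately show ?thesis
      unfolding B_def D_def by (metis imageI)
  qed
  have AB: "A \<inter> B = {z}"
    using z sparse0_Int_sparse1 unfolding A_def B_def z_def by blast
  have AC: "w = z \<or> odd L \<and> w = l" if "w \<in> A" "w \<in> C" for w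
    using that unfolding A_def C_def z_def l_def by (rule sparse0_Int_double0)
  have BC: "w = z" if "w \<in> B" "w \<in> C" for w
    using that unfolding B_def C_def z_def by (rule sparse1_Int_double0)
  have AD: "w = z \<or> w = e" if "w \<in> A" "w \<in> D" for w
    using that unfolding A_def D_def z_def e_def by (rule sparse0_Int_double1)
  have BD: "w = z \<or> even L \<and> w = l" if "w \<in> B" "w \<in> D" for w
    using that unfolding B_def D_def z_def l_def by (rule sparse1_Int_double1)
  have CD: "w = z \<or> w = u" if "w \<in> C" "w \<in> D" for w
    using that unfolding C_def D_def z_def u_def by (rule double0_Int_double1)
  have ABC: "(A \<union> B) \<inter> C = (if odd L then {z, l} else {z})"
    using z l_odd by (auto dest: AC BC)
  have ABCD: "(A \<union> B \<union> C) \<inter> D = (if odd L then {z, e, u} else {z, e, u, l})"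
    using z e u l_even by (auto dest: AD BD CD)
  have split: "row_factors L = A \<union> B \<union> C \<union> D"
    unfolding A_def B_def C_def D_def by (rule row_factors_split)
  \<comment> \<open>The overlaps have sizes 1, 2, 3 for odd \<open>L\<close> and 1, 1, 4 for even
    \<open>L\<close>: 6 in total either way.\<close>
  have "card A + card B = card (A \<union> B) + 1"
    using card_Un_Int[of A B] fin by (simp add: AB)
  moreover have "card (A \<union> B) + card C = card (A \<union> B \<union> C) + (if odd L then 2 else 1)"
    using card_Un_Int[of "A \<union> B" C] fin neq by (simp add: ABC split: if_splits)
  moreover have "card (A \<union> B \<union> C) + card D = card (row_factors L) + (if odd L then 3 else 4)"
    using card_Un_Int[of "A \<union> B \<union> C" D] fin neq by (simp add: ABCD split split: if_splits)
  ultimately show ?thesis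
    using card by (simp split: if_splits)
qed

text \<open>The closed form for positive lengths would give 2 here; this is why downward side length
  1 is exceptional.\<close>

lemma card_row_factors_0: "card (row_factors 0) = 1"
proof -
  have "row_factors 0 = {\<lambda>i. False}"
    by (auto simp: row_factors_def row_factor_def)
  then show ?thesis by simp
qed

lemma card_row_factors_1: "card (row_factors 1) = 2"
proof -
  have "w = (\<lambda>i. False) \<or> w = (\<lambda>i. i = 0)" if "w \<in> row_factors 1" for w
  proof -
    have "w = (\<lambda>i. i = 0 \<and> w 0)"
      using row_factors_beyond[OF that] by (auto simp: fun_eq_iff) (metis Suc_leI neq0_conv)+
    then obtain b where "w = (\<lambda>i. i = 0 \<and> b)" by blast
    then show ?thesis by (cases b) simp_all
  qed
  then have "row_factors 1 = {\<lambda>i. False, \<lambda>i. i = 0}"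
    using zero_in_row_factors first_in_row_factors[of 1] by auto
  moreover have "(\<lambda>i. False) \<noteq> (\<lambda>i::nat. i = 0)"
    by (auto simp: fun_eq_iff)
  ultimately show ?thesis by simp
qed

lemma card_row_factors_2: "card (row_factors 2) = 4"
proof -
  let ?W = "{\<lambda>i. False, \<lambda>i. i = 0, \<lambda>i. i = 1, \<lambda>i. i < (2::nat)}"
  have "w \<in> ?W" if "w \<in> row_factors 2" for w
  proof -
    have "w = (\<lambda>i. i = 0 \<and> w 0 \<or> i = 1 \<and> w 1)"
      using row_factors_beyond[OF that] by (auto simp: fun_eq_iff) (metis less_2_cases not_less)+
    then obtain a b where "w = (\<lambda>i. i = 0 \<and> a \<or> i = 1 \<and> b)" by blast
    then show ?thesis
      by (cases a; cases b) (simp_all add: less_2_cases_iff)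
  qed
  then have "row_factors 2 = ?W"
    using zero_in_row_factors first_in_row_factors[of 2] last_in_row_factors[of 2] ones_in_row_factors[of 2]
    by auto
  moreover have "card ?W = 4"
  proof -
    have "(\<lambda>i. False) \<noteq> (\<lambda>i::nat. i = 0)" "(\<lambda>i. False) \<noteq> (\<lambda>i::nat. i = 1)"
      "(\<lambda>i. False) \<noteq> (\<lambda>i. i < (2::nat))" "(\<lambda>i::nat. i = 0) \<noteq> (\<lambda>i. i = 1)"
      "(\<lambda>i::nat. i = 0) \<noteq> (\<lambda>i. i < (2::nat))" "(\<lambda>i::nat. i = 1) \<noteq> (\<lambda>i. i < (2::nat))"
      by (metis zero_neq_one zero_less_numeral one_less_numeral_iff semiring_norm(76))+
    then show ?thesis by simp
  qed
  ultimately show ?thesis by simp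
qed

theorem card_row_factors:
  "1 \<le> L \<Longrightarrow> int (card (row_factors L)) = int L ^ 2 - int L + 2"
proof (induction L rule: less_induct)
  case (less L)
  \<comment> \<open>The recursion descends only from \<open>3\<close> on, since
    \<open>L div 2 + 1 < L\<close> fails for smaller \<open>L\<close>.\<close>
  consider "L = 1" | "L = 2" | "3 \<le> L"
    using less.prems by linarith
  then show ?case
  proof cases
    case 1
    then show ?thesis by (simp add: card_row_factors_1[simplified])
  next
    case 2
    then show ?thesis by (simp add: card_row_factors_2)
  next
    case 3
    have IH: "int (card (row_factors ((L + 1) div 2))) = int ((L + 1) div 2) ^ 2 - int ((L + 1) div 2) + 2"
      "int (card (row_factors (L div 2))) = int (L div 2) ^ 2 - int (L div 2) + 2"
      "int (card (row_factors (L div 2 + 1))) = int (L div 2 + 1) ^ 2 - int (L div 2 + 1) + 2"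
      using 3 by (intro less.IH; linarith)+
    obtain k where k: "L = 2 * k \<or> L = 2 * k + 1"
      by (metis oddE evenE)
    have "int (card (row_factors L)) + 6 = 2 * int (card (row_factors ((L + 1) div 2)))
        + int (card (row_factors (L div 2))) + int (card (row_factors (L div 2 + 1)))"
      using card_row_factors_split[OF 3] by linarith
    then show ?thesis
      unfolding IH using k by (auto simp: power2_eq_square algebra_simps)
  qed
qed

section \<open>Triangular patterns as row factors\<close>

lemma row_factor_eq_iff:
  "row_factor L r j = row_factor L r' j' \<longleftrightarrow>
    (\<forall>i<L. pascal2 r (j + int i) = pascal2 r' (j' + int i))"
  by (auto simp: row_factor_def fun_eq_iff)

text \<open>Patterns must lie inside the triangle, whereas factors may reach into the padding;
  interior copies show that the restriction loses no factor.\<close>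

lemma row_factors_interior:
  "row_factors L = (\<lambda>(r, j). row_factor L r (int j)) ` {(r, j). 1 \<le> j \<and> j + L \<le> r}"
proof
  show "row_factors L \<subseteq> (\<lambda>(r, j). row_factor L r (int j)) ` {(r, j). 1 \<le> j \<and> j + L \<le> r}"
  proof
    fix w assume "w \<in> row_factors L"
    then obtain r j where w: "w = row_factor L r j"
      by (auto simp: row_factors_def)
    obtain r' j' where "1 \<le> j'" "j' + L \<le> r'"
      and "\<And>i. i < L \<Longrightarrow> pascal2 r' (int j' + int i) = pascal2 r (j + int i)"
      by (rule pascal2_interior_copy[where L = L and r = r and j = j]) blast
    then show "w \<in> (\<lambda>(r, j). row_factor L r (int j)) ` {(r, j). 1 \<le> j \<and> j + L \<le> r}"
      unfolding w by (intro rev_image_eqI[of "(r', j')"]) (auto simp: row_factor_eq_iff)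
  qed
qed (auto simp: row_factors_def)

lemma sierpinski_even: "sierpinski r (2 * c) = (if pascal2 r (int c) then Filled else Unfilled)"
  by (simp add: sierpinski_def pascal2_def)

lemma sierpinski_odd: "odd c \<Longrightarrow> sierpinski r c = Unfilled"
  by (simp add: sierpinski_def)

text \<open>A cell \<open>i\<close> rows further down depends only on the \<open>i + 1\<close> cells
  in columns \<open>c - i\<close> to \<open>c\<close> of the starting row.\<close>

lemma pascal2_cone:
  assumes "\<And>d. c - int i \<le> d \<Longrightarrow> d \<le> c \<Longrightarrow> pascal2 r (j + d) = pascal2 r' (j' + d)"
  shows "pascal2 (r + i) (j + c) = pascal2 (r' + i) (j' + c)"
  using assms
proof (induction i arbitrary: c)
  case 0
  then show ?case by simp
next
  case (Suc i)
  have "pascal2 (r + i) (j + c) = pascal2 (r' + i) (j' + c)"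
    "pascal2 (r + i) (j + (c - 1)) = pascal2 (r' + i) (j' + (c - 1))"
    by (rule Suc.IH; rule Suc.prems; simp)+
  then show ?case
    by (simp add: pascal2_Suc add_diff_eq)
qed

text \<open>
  Pascal's rule, solved for either of the two upper cells, extends agreement on an upward triangle
  by one cell at both ends of every row but the last; \<open>t\<close> counts these extensions.
\<close>

lemma pascal2_from_up_triangle:
  assumes "\<And>i k. i < n \<Longrightarrow> k \<le> i \<Longrightarrow> pascal2 (r + i) (j + int k) = pascal2 (r' + i) (j' + int k)"
  shows "i + t < n \<Longrightarrow> - int t \<le> d \<Longrightarrow> d \<le> int i + int t \<Longrightarrow>
    pascal2 (r + i) (j + d) = pascal2 (r' + i) (j' + d)"
proof (induction t arbitrary: i d)
  case 0
  then show ?case using assms[of i "nat d"] by simp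
next
  case (Suc t)
  consider "- int t \<le> d" "d \<le> int i + int t" | "d = - int t - 1" | "d = int i + int t + 1"
    using Suc.prems by linarith
  then show ?case
  proof cases
    case 1
    then show ?thesis using Suc by simp
  next
    case 2
    have "pascal2 (r + Suc i) (j + (d + 1)) = pascal2 (r' + Suc i) (j' + (d + 1))"
      "pascal2 (r + i) (j + (d + 1)) = pascal2 (r' + i) (j' + (d + 1))"
      using Suc.prems 2 by (intro Suc.IH; simp)+
    then show ?thesis
      by (auto simp: pascal2_Suc algebra_simps)
  next
    case 3
    have "pascal2 (r + Suc i) (j + d) = pascal2 (r' + Suc i) (j' + d)"
      "pascal2 (r + i) (j + (d - 1)) = pascal2 (r' + i) (j' + (d - 1))"
      using Suc.prems 3 by (intro Suc.IH; simp)+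
    then show ?thesis
      by (auto simp: pascal2_Suc algebra_simps)
  qed
qed

text \<open>Forwards, \<open>n - 1\<close> extensions at both ends widen the apex to the whole
  stretch; backwards, the cone of every cell of the triangle lies within the stretch.\<close>

lemma up_pattern_eq_iff:
  assumes "1 \<le> n"
  shows "up_pattern_at n r (2 * j) = up_pattern_at n r' (2 * j') \<longleftrightarrow>
    row_factor (2 * n - 1) r (int j - int (n - 1)) = row_factor (2 * n - 1) r' (int j' - int (n - 1))"
    (is "?P = ?Q")
proof
  assume ?P
  have cell: "pascal2 (r + i) (int j + int k) = pascal2 (r' + i) (int j' + int k)"
    if "i < n" "k \<le> i" for i k
  proof -
    have "up_pattern_at n r (2 * j) (i, 2 * k) = up_pattern_at n r' (2 * j') (i, 2 * k)"
      using \<open>?P\<close> by simp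
    then show ?thesis
      using that sierpinski_even[of "r + i" "j + k"] sierpinski_even[of "r' + i" "j' + k"]
      by (simp add: up_pattern_at_def up_domain_def split: if_splits)
  qed
  have "pascal2 (r + 0) (int j + d) = pascal2 (r' + 0) (int j' + d)"
    if "- int (n - 1) \<le> d" "d \<le> int (n - 1)" for d
    using cell by (rule pascal2_from_up_triangle[of n r "int j" r' "int j'" 0 "n - 1"]) (use assms that in auto)
  from this[of "int i - int (n - 1)" for i] show ?Q
    by (auto simp: row_factor_eq_iff algebra_simps)
next
  assume ?Q
  have row: "pascal2 r (int j + d) = pascal2 r' (int j' + d)"
    if "- int (n - 1) \<le> d" "d \<le> int (n - 1)" for d
  proof -
    have "nat (d + int (n - 1)) < 2 * n - 1"
      using that assms by linarith
    moreover have "int (nat (d + int (n - 1))) = d + int (n - 1)"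
      using that by simp
    ultimately show ?thesis
      using \<open>?Q\<close> unfolding row_factor_eq_iff by (metis add.assoc add.commute diff_add_cancel)
  qed
  have cell: "sierpinski (r + i) (2 * j + k) = sierpinski (r' + i) (2 * j' + k)"
    if "i \<le> n - 1" "k \<le> 2 * i" for i k
  proof (cases "even k")
    case True
    then obtain k' where k': "k = 2 * k'" by blast
    have "pascal2 (r + i) (int j + int k') = pascal2 (r' + i) (int j' + int k')"
      by (rule pascal2_cone, rule row) (use that k' in auto)
    then show ?thesis
      using sierpinski_even[of "r + i" "j + k'"] sierpinski_even[of "r' + i" "j' + k'"]
      by (simp add: k')
  next
    case False
    then show ?thesis by (simp add: sierpinski_odd)
  qed
  then show ?P
    by (auto simp: up_pattern_at_def up_domain_def restrict_def fun_eq_iff)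
qed

text \<open>The top row starts with a downward cell, so its upward cells sit at odd offsets
  \<open>2 * l + 1\<close>, in binomial columns \<open>j + 1 + l\<close>. The cones of all lower
  upward cells end in these.\<close>

lemma down_pattern_eq_iff:
  assumes "1 \<le> n"
  shows "down_pattern_at n r (2 * j + 1) = down_pattern_at n r' (2 * j' + 1) \<longleftrightarrow>
    row_factor (n - 1) r (int (j + 1)) = row_factor (n - 1) r' (int (j' + 1))"
    (is "?P = ?Q")
proof
  assume ?P
  have "pascal2 r (int (j + 1) + int l) = pascal2 r' (int (j' + 1) + int l)" if "l < n - 1" for l
  proof -
    have "down_pattern_at n r (2 * j + 1) (0, 2 * l + 1) = down_pattern_at n r' (2 * j' + 1) (0, 2 * l + 1)"
      using \<open>?P\<close> by simp
    moreover have "(0, 2 * l + 1) \<in> down_domain n"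
      using that by (auto simp: down_domain_def)
    ultimately show ?thesis
      using sierpinski_even[of r "j + 1 + l"] sierpinski_even[of r' "j' + 1 + l"]
      by (simp add: down_pattern_at_def ac_simps split: if_splits)
  qed
  then show ?Q by (simp add: row_factor_eq_iff)
next
  assume ?Q
  have row: "pascal2 r (int (j + 1) + d) = pascal2 r' (int (j' + 1) + d)"
    if "0 \<le> d" "d < int (n - 1)" for d
    using \<open>?Q\<close> that unfolding row_factor_eq_iff by (metis nonneg_int_cases of_nat_less_iff)
  have cell: "sierpinski (r + i) (2 * j + 1 + 2 * i + k) = sierpinski (r' + i) (2 * j' + 1 + 2 * i + k)"
    if "i \<le> n - 1" "k \<le> 2 * (n - i) - 2" for i k
  proof (cases "even k")
    case True
    then show ?thesis by (simp add: sierpinski_odd)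
  next
    case False
    then obtain l where l: "k = 2 * l + 1" by (metis oddE)
    have "pascal2 (r + i) (int (j + 1) + int (i + l)) = pascal2 (r' + i) (int (j' + 1) + int (i + l))"
      by (rule pascal2_cone, rule row) (use that l in auto)
    then show ?thesis
      using sierpinski_even[of "r + i" "j + 1 + (i + l)"] sierpinski_even[of "r' + i" "j' + 1 + (i + l)"]
      by (simp add: l algebra_simps)
  qed
  then show ?P
    by (auto simp: down_pattern_at_def down_domain_def restrict_def fun_eq_iff)
qed

section \<open>Counting patterns by counting factors\<close>

lemma finite_card_image_cong:
  assumes "finite (G ` S)" "\<And>p q. p \<in> S \<Longrightarrow> q \<in> S \<Longrightarrow> F p = F q \<longleftrightarrow> G p = G q"
  shows "finite (F ` S) \<and> card (F ` S) = card (G ` S)"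
proof -
  \<comment> \<open>\<open>F\<close> and \<open>G\<close> identify the same points of
    \<open>S\<close>, so the chosen preimage does not matter.\<close>
  have "bij_betw (\<lambda>y. G (inv_into S F y)) (F ` S) (G ` S)"
    unfolding bij_betw_def
  proof
    show "inj_on (\<lambda>y. G (inv_into S F y)) (F ` S)"
      by (rule inj_onI) (metis assms(2) f_inv_into_f inv_into_into)
    show "(\<lambda>y. G (inv_into S F y)) ` F ` S = G ` S"
      by (auto simp: image_iff) (metis assms(2) f_inv_into_f imageI inv_into_into)+
  qed
  then show ?thesis
    using assms(1) bij_betw_finite bij_betw_same_card by blast
qed

lemma card_up_patterns:
  assumes "1 \<le> n"
  shows "finite (up_patterns n) \<and> card (up_patterns n) = card (row_factors (2 * n - 1))"
proof -
  define S where "S = {(r, j). j \<le> (r::nat)}"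
  define F where "F = (\<lambda>(r, j). up_pattern_at n r (2 * j))"
  define G where "G = (\<lambda>(r, j). row_factor (2 * n - 1) r (int j - int (n - 1)))"
  have "up_patterns n = F ` S"
    unfolding up_patterns_def F_def S_def by (auto simp: image_iff elim!: evenE) fastforce
  moreover have "row_factors (2 * n - 1) = G ` S"
  proof
    show "row_factors (2 * n - 1) \<subseteq> G ` S"
      unfolding row_factors_interior
    proof clarify
      fix r j :: nat assume "1 \<le> j" "j + (2 * n - 1) \<le> r"
      then show "row_factor (2 * n - 1) r (int j) \<in> G ` S"
        \<comment> \<open>The apex is the centre of the window of length
          \<open>2 * n - 1\<close>.\<close>
        using assms by (intro rev_image_eqI[of "(r, j + (n - 1))"]) (auto simp: S_def G_def)
    qed
  qed (auto simp: row_factors_def G_def)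
  moreover have "F p = F q \<longleftrightarrow> G p = G q" for p q
    using up_pattern_eq_iff[OF assms] by (cases p; cases q) (simp add: F_def G_def)
  ultimately show ?thesis
    using finite_card_image_cong[of G S F] finite_row_factors[of "2 * n - 1"] by simp
qed

lemma card_down_patterns:
  assumes "1 \<le> n"
  shows "finite (down_patterns n) \<and> card (down_patterns n) = card (row_factors (n - 1))"
proof -
  \<comment> \<open>With \<open>c = 2 * j + 1\<close>, the bound
    \<open>c + 2 * n - 2 \<le> 2 * r\<close> becomes \<open>j + n \<le> r\<close> by parity.\<close>
  define S where "S = {(r, j). j + n \<le> (r::nat)}"
  define F where "F = (\<lambda>(r, j). down_pattern_at n r (2 * j + 1))"
  define G where "G = (\<lambda>(r, j). row_factor (n - 1) r (int (j + 1)))"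
  have "down_patterns n = F ` S"
  proof
    show "down_patterns n \<subseteq> F ` S"
    proof
      fix w assume "w \<in> down_patterns n"
      then obtain r j where "w = down_pattern_at n r (2 * j + 1)" "2 * j + 1 + 2 * n - 2 \<le> 2 * r"
        by (auto simp: down_patterns_def elim!: oddE)
      then show "w \<in> F ` S"
        using assms by (intro rev_image_eqI[of "(r, j)"]) (auto simp: F_def S_def)
    qed
    show "F ` S \<subseteq> down_patterns n"
    proof
      fix w assume "w \<in> F ` S"
      then obtain r j where "w = down_pattern_at n r (2 * j + 1)" "j + n \<le> r"
        by (auto simp: F_def S_def)
      then show "w \<in> down_patterns n"
        unfolding down_patterns_def by (intro CollectI exI[of _ r] exI[of _ "2 * j + 1"]) auto
    qed
  qed
  moreover have "row_factors (n - 1) = G ` S"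
  proof
    show "row_factors (n - 1) \<subseteq> G ` S"
      unfolding row_factors_interior
    proof clarify
      fix r j :: nat assume "1 \<le> j" "j + (n - 1) \<le> r"
      then show "row_factor (n - 1) r (int j) \<in> G ` S"
        \<comment> \<open>The factor of position \<open>j\<close> starts at \<open>j + 1\<close>, so
          a window starting at \<open>j \<ge> 1\<close> belongs to position
          \<open>j - 1\<close>.\<close>
        using assms by (intro rev_image_eqI[of "(r, j - 1)"]) (auto simp: S_def G_def)
    qed
  qed (auto simp: row_factors_def G_def)
  moreover have "F p = F q \<longleftrightarrow> G p = G q" for p q
    using down_pattern_eq_iff[OF assms] by (cases p; cases q) (simp add: F_def G_def)
  ultimately show ?thesis
    using finite_card_image_cong[of G S F] finite_row_factors[of "n - 1"] by simp
qed

theorem theorem1: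
  shows "(\<forall>n\<ge>1. finite (up_patterns n) \<and>
            int (card (up_patterns n)) = 4 * int n ^ 2 - 6 * int n + 4) \<and>
         finite (down_patterns 1) \<and> card (down_patterns 1) = 1 \<and>
         (\<forall>n\<ge>2. finite (down_patterns n) \<and>
            int (card (down_patterns n)) = int n ^ 2 - 3 * int n + 4)"
proof (intro conjI allI impI)
  fix n :: nat assume n: "1 \<le> n"
  show "finite (up_patterns n)"
    using card_up_patterns[OF n] by simp
  \<comment> \<open>Substituting \<open>L = 2 * n - 1\<close> in \<open>L^2 - L + 2\<close> gives
    the upward count.\<close>
  have "int (2 * n - 1) = 2 * int n - 1"
    using n by simp
  then show "int (card (up_patterns n)) = 4 * int n ^ 2 - 6 * int n + 4"
    using card_up_patterns[OF n] card_row_factors[of "2 * n - 1"] n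
    by (simp add: power2_eq_square algebra_simps)
next
  show "finite (down_patterns 1)" "card (down_patterns 1) = 1"
    using card_down_patterns[of 1] card_row_factors_0 by simp_all
next
  fix n :: nat assume n: "2 \<le> n"
  show "finite (down_patterns n)"
    using card_down_patterns[of n] n by simp
  have "int (n - 1) = int n - 1"
    using n by simp
  then show "int (card (down_patterns n)) = int n ^ 2 - 3 * int n + 4"
    using card_down_patterns[of n] card_row_factors[of "n - 1"] n
    by (simp add: power2_eq_square algebra_simps)
qed

end
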